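(* For every positive integer $r$, $\sigma\big(\mathrm{Cay}(\mathbb{Z}_3^r,\{(1,0,\dots,0),(0,1,0,\dots,0),\dots,(0,\dots,0,1)\})\big)=1$.
   Context: For an abelian group $\Gamma$ and $C\subseteq\Gamma$, $\mathrm{Cay}(\Gamma,C)$ is the simple undirected graph on $\Gamma$ with $\{x,y\}$ an edge iff $y-x\in C$ or $x-y\in C$ (so here $x\sim y$ iff they differ in exactly one coordinate). For a graph $G$, $\alpha(G)$ is its independence number and $\sigma(G)$ is the minimum of the maximum degree of $G[K]$ over all vertex sets $K$ with $|K|>\alpha(G)$. *)

theory Defs
  imports "HOL-Algebra.Elementary_Groups" "HOL-Algebra.Product_Groups" "HOL-Library.Ramsey"
begin

text \<open>A graph is a pair of a vertex set and a set of two-element edges. As the graphs are meant to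
  be finite, all invariants below use \<^const>\<open>Min\<close> and \<^const>\<open>Max\<close>, which are unspecified on
  empty or infinite sets.\<close>

type_synonym 'v graph = "'v set \<times> 'v set set"

definition verts :: "'v graph \<Rightarrow> 'v set" where
  "verts G = fst G"

definition edges :: "'v graph \<Rightarrow> 'v set set" where
  "edges G = snd G"

definition induced_subgraph :: "'v graph \<Rightarrow> 'v set \<Rightarrow> 'v graph" where
  "induced_subgraph G K = (K, {e \<in> edges G. e \<subseteq> K})"

definition degree :: "'v graph \<Rightarrow> 'v \<Rightarrow> nat" where
  "degree G v = card {e \<in> edges G. v \<in> e}"

definition max_degree :: "'v graph \<Rightarrow> nat" where
  "max_degree G = Max (degree G ` verts G)"

definition independence_number :: "'v graph \<Rightarrow> nat" where
  "independence_number G = Max {card S | S. S \<subseteq> verts G \<and> indep S (edges G)}"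

text \<open>The minimum ranges over a nonempty set exactly when the (finite) graph has an edge.\<close>

definition sensitivity :: "'v graph \<Rightarrow> nat" where
  "sensitivity G =
     Min {max_degree (induced_subgraph G K) | K. K \<subseteq> verts G \<and> card K > independence_number G}"

text \<open>Groups in HOL-Algebra are written multiplicatively, so the difference \<open>y - x\<close> of the abelian
  group is \<open>y \<otimes> inv x\<close>. Loops, which would arise if \<open>C\<close> contained the neutral element, are
  discarded.\<close>

definition cayley_graph :: "('a, 'b) monoid_scheme \<Rightarrow> 'a set \<Rightarrow> 'a graph" where
  "cayley_graph \<Gamma> C =
     (carrier \<Gamma>,
      {{x, y} | x y. x \<in> carrier \<Gamma> \<and> y \<in> carrier \<Gamma> \<and> x \<noteq> y \<and>
         (y \<otimes>\<^bsub>\<Gamma>\<^esub> inv\<^bsub>\<Gamma>\<^esub> x \<in> C \<or> x \<otimes>\<^bsub>\<Gamma>\<^esub> inv\<^bsub>\<Gamma>\<^esub> y \<in> C)})"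

text \<open>The group \<open>\<int>\<^sub>n\<^sup>r\<close>: functions on the index set \<open>{..<r}\<close>, extended by \<^const>\<open>undefined\<close>
  outside it, with values in \<open>{0..<n}\<close> (for \<open>n > 0\<close>).\<close>

definition int_mod_power :: "nat \<Rightarrow> nat \<Rightarrow> (nat \<Rightarrow> int) monoid" where
  "int_mod_power n r = product_group {..<r} (\<lambda>_. integer_mod_group n)"

definition unit_vector :: "nat \<Rightarrow> nat \<Rightarrow> nat \<Rightarrow> int" where
  "unit_vector r i = (\<lambda>j\<in>{..<r}. if j = i then 1 else 0)"

end

theory Submission
  imports Defs
begin

text \<open>The vertices are the ternary words of length \<open>r\<close>, and two of them are adjacent iff they differ
  in exactly one coordinate. Forgetting the last coordinate is injective on an independent set, so
  independent sets have at most \<open>3 ^ (r - 1)\<close> elements, and a larger set induces at least one edge.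
  Conversely, let \<open>K\<close> consist of the nonzero words \<open>x\<close> such that the sum of the coordinates before
  the last nonzero one, at position \<open>i\<close>, say, is divisible by 3. This set has \<open>3 ^ (r - 1) + 1\<close>
  elements, and the only neighbour of \<open>x\<close> in \<open>K\<close> is obtained by swapping the values 1 and 2
  at position \<open>i\<close>.\<close>

section \<open>Edges and degrees\<close>

definition ternary_words :: "nat \<Rightarrow> (nat \<Rightarrow> int) set" where
  "ternary_words r = ({..<r} \<rightarrow>\<^sub>E {0..<3})"

text \<open>The index may be any natural number: words of length \<open>r\<close> are both
  \<open>undefined\<close> outside \<open>{..<r}\<close>, so on them this is Hamming distance
  one.\<close>

definition differ_once :: "(nat \<Rightarrow> int) \<Rightarrow> (nat \<Rightarrow> int) \<Rightarrow> bool" where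
  "differ_once x y \<longleftrightarrow> (\<exists>i. x i \<noteq> y i \<and> (\<forall>j. j \<noteq> i \<longrightarrow> x j = y j))"

abbreviation hamming_graph :: "nat \<Rightarrow> (nat \<Rightarrow> int) graph" where
  "hamming_graph r \<equiv> cayley_graph (int_mod_power 3 r) {unit_vector r i | i. i < r}"

lemma ternary_words_range:
  assumes "x \<in> ternary_words r" "i < r"
  shows "x i \<in> {0, 1, 2}"
proof -
  have "x i \<in> {0..<3}"
    using assms unfolding ternary_words_def by (metis PiE_mem lessThan_iff)
  then have "0 \<le> x i" "x i < 3"
    by simp_all
  then have "x i = 0 \<or> x i = 1 \<or> x i = 2"
    by linarith
  then show ?thesis
    by simp
qed

lemma ternary_words_undefined: "x \<in> ternary_words r \<Longrightarrow> \<not> i < r \<Longrightarrow> x i = undefined"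
  unfolding ternary_words_def by (metis PiE_arb lessThan_iff)

lemma finite_ternary_words: "finite (ternary_words r)"
  by (simp add: ternary_words_def finite_PiE)

lemma card_ternary_words: "card (ternary_words r) = 3 ^ r"
  by (simp add: ternary_words_def card_funcsetE)

lemma carrier_int_mod_power_3: "carrier (int_mod_power 3 r) = ternary_words r"
  by (simp add: int_mod_power_def carrier_integer_mod_group ternary_words_def)

lemma differ_once_commute: "differ_once x y \<longleftrightarrow> differ_once y x"
  unfolding differ_once_def by metis

lemma diff_int_mod_power_3:
  assumes "x \<in> ternary_words r" "y \<in> ternary_words r"
  shows "y \<otimes>\<^bsub>int_mod_power 3 r\<^esub> inv\<^bsub>int_mod_power 3 r\<^esub> x = (\<lambda>i\<in>{..<r}. (y i - x i) mod 3)"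
proof -
  have x: "x \<in> (\<Pi>\<^sub>E i\<in>{..<r}. carrier (integer_mod_group 3))"
    using assms by (simp add: ternary_words_def carrier_integer_mod_group)
  then have "x i \<in> carrier (integer_mod_group 3)" if "i < r" for i
    using that by auto
  then show ?thesis
    using x by (auto simp: int_mod_power_def mod_simps intro!: restrict_ext)
qed

lemma diff_eq_unit_vector_iff:
  assumes x: "x \<in> ternary_words r" and y: "y \<in> ternary_words r" and i: "i < r"
  shows "y \<otimes>\<^bsub>int_mod_power 3 r\<^esub> inv\<^bsub>int_mod_power 3 r\<^esub> x = unit_vector r i \<longleftrightarrow>
    (y i - x i) mod 3 = 1 \<and> (\<forall>j. j \<noteq> i \<longrightarrow> x j = y j)"
proof -
  \<comment> \<open>Entries are canonical residues 0, 1, 2, and distinct ones are incongruent mod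
    3.\<close>
  have zero: "(y j - x j) mod 3 = 0 \<longleftrightarrow> x j = y j" if "j < r" for j
    using ternary_words_range[OF x that] ternary_words_range[OF y that] by auto
  have "y \<otimes>\<^bsub>int_mod_power 3 r\<^esub> inv\<^bsub>int_mod_power 3 r\<^esub> x = unit_vector r i \<longleftrightarrow>
    (\<forall>j<r. (y j - x j) mod 3 = (if j = i then 1 else 0))"
    unfolding diff_int_mod_power_3[OF x y] unit_vector_def
    by (auto simp: fun_eq_iff restrict_def)
  also have "\<dots> \<longleftrightarrow> (y i - x i) mod 3 = 1 \<and> (\<forall>j<r. j \<noteq> i \<longrightarrow> x j = y j)"
    using i zero by auto
  also have "\<dots> \<longleftrightarrow> (y i - x i) mod 3 = 1 \<and> (\<forall>j. j \<noteq> i \<longrightarrow> x j = y j)"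
    using ternary_words_undefined[OF x] ternary_words_undefined[OF y] by metis
  finally show ?thesis .
qed

text \<open>Every nonzero residue mod 3 is 1 or -1, so any change of a single coordinate is a step
  along a unit vector in one of the two directions.\<close>

lemma diff_in_unit_vectors_iff:
  assumes x: "x \<in> ternary_words r" and y: "y \<in> ternary_words r"
  shows "y \<otimes>\<^bsub>int_mod_power 3 r\<^esub> inv\<^bsub>int_mod_power 3 r\<^esub> x \<in> {unit_vector r i | i. i < r} \<or>
     x \<otimes>\<^bsub>int_mod_power 3 r\<^esub> inv\<^bsub>int_mod_power 3 r\<^esub> y \<in> {unit_vector r i | i. i < r} \<longleftrightarrow>
    differ_once x y" (is "?L \<longleftrightarrow> _")
proof -
  have "?L \<longleftrightarrow> (\<exists>i<r. ((y i - x i) mod 3 = 1 \<or> (x i - y i) mod 3 = 1) \<and>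
      (\<forall>j. j \<noteq> i \<longrightarrow> x j = y j))"
    unfolding mem_Collect_eq
    using diff_eq_unit_vector_iff[OF x y] diff_eq_unit_vector_iff[OF y x]
    by (smt (verit, best))
  also have "\<dots> \<longleftrightarrow> (\<exists>i<r. x i \<noteq> y i \<and> (\<forall>j. j \<noteq> i \<longrightarrow> x j = y j))"
  proof -
    have "(y i - x i) mod 3 = 1 \<or> (x i - y i) mod 3 = 1 \<longleftrightarrow> x i \<noteq> y i" if "i < r" for i
      using ternary_words_range[OF x that] ternary_words_range[OF y that] by auto
    then show ?thesis by auto
  qed
  also have "\<dots> \<longleftrightarrow> differ_once x y"
    unfolding differ_once_def
    using ternary_words_undefined[OF x] ternary_words_undefined[OF y] by metis
  finally show ?thesis .
qed

lemma verts_hamming_graph: "verts (hamming_graph r) = ternary_words r"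
  by (simp add: verts_def cayley_graph_def carrier_int_mod_power_3)

lemma edges_hamming_graph:
  "edges (hamming_graph r) =
    {{x, y} | x y. x \<in> ternary_words r \<and> y \<in> ternary_words r \<and> differ_once x y}"
proof -
  let ?\<Gamma> = "int_mod_power 3 r" and ?C = "{unit_vector r i | i. i < r}"
  have "x \<in> ternary_words r \<and> y \<in> ternary_words r \<and> x \<noteq> y \<and>
      (y \<otimes>\<^bsub>?\<Gamma>\<^esub> inv\<^bsub>?\<Gamma>\<^esub> x \<in> ?C \<or> x \<otimes>\<^bsub>?\<Gamma>\<^esub> inv\<^bsub>?\<Gamma>\<^esub> y \<in> ?C) \<longleftrightarrow>
    x \<in> ternary_words r \<and> y \<in> ternary_words r \<and> differ_once x y" for x y
  proof (cases "x \<in> ternary_words r \<and> y \<in> ternary_words r")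
    case True
    then show ?thesis
      unfolding diff_in_unit_vectors_iff[OF conjunct1[OF True] conjunct2[OF True]]
      by (auto simp: differ_once_def)
  qed auto
  then show ?thesis
    unfolding edges_def cayley_graph_def snd_conv carrier_int_mod_power_3 by presburger
qed

lemma pair_in_edges_hamming_graph_iff:
  "{x, y} \<in> edges (hamming_graph r) \<longleftrightarrow>
    x \<in> ternary_words r \<and> y \<in> ternary_words r \<and> differ_once x y"
  by (auto simp: edges_hamming_graph doubleton_eq_iff differ_once_commute)

text \<open>Each edge at \<open>x\<close> is determined by its other endpoint, so edges can be
  counted as neighbours.\<close>

lemma degree_induced_hamming_graph:
  assumes "K \<subseteq> ternary_words r" "x \<in> K"
  shows "degree (induced_subgraph (hamming_graph r) K) x = card {y \<in> K. differ_once x y}"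
proof -
  have "{e \<in> edges (induced_subgraph (hamming_graph r) K). x \<in> e} =
      (\<lambda>y. {x, y}) ` {y \<in> K. differ_once x y}"
    using assms
    by (auto simp: induced_subgraph_def edges_def[of "(_, _)"] edges_hamming_graph
        differ_once_commute)
  moreover have "inj (\<lambda>y. {x, y})"
    by (auto simp: inj_on_def doubleton_eq_iff)
  ultimately show ?thesis
    unfolding degree_def by (simp add: card_image inj_on_subset)
qed

section \<open>Independent sets\<close>

lemma restrict_in_ternary_words:
  "x \<in> ternary_words (Suc n) \<Longrightarrow> restrict x {..<n} \<in> ternary_words n"
  unfolding ternary_words_def restrict_PiE_iff by (metis PiE_mem lessThan_iff less_SucI)

text \<open>Words with the same first \<open>n\<close> coordinates form a clique, so
  \<open>S\<close> meets each of the \<open>3 ^ n\<close> fibres of the restriction at most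
  once.\<close>

lemma card_independent_le:
  assumes S: "S \<subseteq> ternary_words (Suc n)" and indep: "indep S (edges (hamming_graph (Suc n)))"
  shows "card S \<le> 3 ^ n"
proof -
  have "inj_on (\<lambda>x. restrict x {..<n}) S"
  proof (rule inj_onI, rule ccontr)
    fix x y
    assume xy: "x \<in> S" "y \<in> S" and eq: "restrict x {..<n} = restrict y {..<n}" and "x \<noteq> y"
    have "x j = y j" if "j \<noteq> n" for j
    proof (cases "j < n")
      case True
      then show ?thesis using eq by (metis lessThan_iff restrict_apply')
    next
      case False
      then show ?thesis
        using that xy S by (metis ternary_words_undefined less_SucE subsetD)
    qed
    moreover from this have "x n \<noteq> y n"
      using \<open>x \<noteq> y\<close> by (metis ext)
    ultimately have "{x, y} \<in> edges (hamming_graph (Suc n))"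
      unfolding pair_in_edges_hamming_graph_iff differ_once_def using xy S by auto
    then show False
      using indep xy \<open>x \<noteq> y\<close> by (auto simp: indep_def)
  qed
  moreover have "(\<lambda>x. restrict x {..<n}) ` S \<subseteq> ternary_words n"
    using S restrict_in_ternary_words by auto
  ultimately have "card S \<le> card (ternary_words n)"
    using card_inj_on_le finite_ternary_words by blast
  then show ?thesis
    by (simp add: card_ternary_words)
qed

lemma finite_independent_cards:
  "finite {card S | S. S \<subseteq> verts (hamming_graph r) \<and> indep S (edges (hamming_graph r))}"
proof -
  have "finite (card ` Pow (ternary_words r))"
    by (simp add: finite_ternary_words)
  then show ?thesis
    by (rule rev_finite_subset) (auto simp: verts_hamming_graph)
qed

lemma card_le_independence_number:
  assumes "S \<subseteq> ternary_words r" "indep S (edges (hamming_graph r))"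
  shows "card S \<le> independence_number (hamming_graph r)"
  unfolding independence_number_def
  using assms by (intro Max_ge[OF finite_independent_cards]) (auto simp: verts_hamming_graph)

lemma independence_number_le: "independence_number (hamming_graph (Suc n)) \<le> 3 ^ n"
  unfolding independence_number_def
  using card_independent_le[of _ n]
  \<comment> \<open>\<open>Max\<close> must range over a nonempty set; the empty independent set
    provides a member.\<close>
  by (subst Max_le_iff[OF finite_independent_cards])
    (auto simp: verts_hamming_graph intro: exI[of _ "{}"])

lemma max_degree_ge_1:
  assumes K: "K \<subseteq> ternary_words r" and card: "independence_number (hamming_graph r) < card K"
  shows "1 \<le> max_degree (induced_subgraph (hamming_graph r) K)"
proof -
  have fin: "finite K"
    using K finite_ternary_words finite_subset by blast
  have "\<not> indep K (edges (hamming_graph r))"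
    using card_le_independence_number[OF K] card by auto
  then obtain x y where xy: "x \<in> K" "y \<in> K" "differ_once x y"
    by (auto simp: indep_def pair_in_edges_hamming_graph_iff)
  then have "1 \<le> card {y \<in> K. differ_once x y}"
    using fin by (auto simp: Suc_le_eq card_gt_0_iff)
  also have "\<dots> = degree (induced_subgraph (hamming_graph r) K) x"
    using degree_induced_hamming_graph[OF K xy(1)] by simp
  also have "\<dots> \<le> max_degree (induced_subgraph (hamming_graph r) K)"
    unfolding max_degree_def
    using fin xy(1) by (intro Max_ge) (auto simp: verts_def induced_subgraph_def)
  finally show ?thesis .
qed

section \<open>A large set inducing a matching\<close>

text \<open>The kernel of the coordinate sum into the integers mod 3. These are the prefixes that
  may precede a last nonzero coordinate in the large set.\<close>

definition sum_zero_words :: "nat \<Rightarrow> (nat \<Rightarrow> int) set" where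
  "sum_zero_words r = {x \<in> ternary_words r. 3 dvd sum x {..<r}}"

text \<open>Read from the right, \<open>i\<close> is the first nonzero position, hence unique. The
  sum stops before \<open>i\<close>, so swapping 1 and 2 at \<open>i\<close> preserves the
  condition.\<close>

definition leads :: "(nat \<Rightarrow> int) \<Rightarrow> nat \<Rightarrow> nat \<Rightarrow> bool" where
  "leads x r i \<longleftrightarrow> i < r \<and> x i \<noteq> 0 \<and> (\<forall>j\<in>{i<..<r}. x j = 0) \<and> 3 dvd sum x {..<i}"

definition matching_words :: "nat \<Rightarrow> (nat \<Rightarrow> int) set" where
  "matching_words r = {x \<in> ternary_words r. \<exists>i. leads x r i}"

section \<open>Cardinality of the large set\<close>

lemma ternary_words_Suc:
  "x \<in> ternary_words (Suc n) \<longleftrightarrow> (\<exists>g\<in>ternary_words n. \<exists>c\<in>{0, 1, 2}. x = g(n := c))"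
proof -
  have range: "{0..<3} = {0, 1, 2 :: int}" by auto
  have "ternary_words (Suc n) = (\<lambda>(c, g). g(n := c)) ` ({0, 1, 2} \<times> ternary_words n)"
    unfolding ternary_words_def lessThan_Suc PiE_insert_eq range by (rule refl)
  then show ?thesis
    by auto
qed

lemma upd_in_ternary_words:
  "g \<in> ternary_words n \<Longrightarrow> c \<in> {0, 1, 2} \<Longrightarrow> g(n := c) \<in> ternary_words (Suc n)"
  unfolding ternary_words_Suc by (rule bexI, rule bexI, rule refl)

lemma sum_upd_above: "(n::nat) \<ge> m \<Longrightarrow> sum (g(n := (c::int))) {..<m} = sum g {..<m}"
  by (rule sum.cong) auto

text \<open>The first \<open>n\<close> coordinates are free and the last is determined by
  them.\<close>

lemma card_sum_zero_words_Suc: "card (sum_zero_words (Suc n)) = 3 ^ n"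
proof -
  have "bij_betw (\<lambda>g. g(n := (- sum g {..<n}) mod 3)) (ternary_words n) (sum_zero_words (Suc n))"
  proof (rule bij_betw_imageI)
    show "inj_on (\<lambda>g. g(n := (- sum g {..<n}) mod 3)) (ternary_words n)"
    proof (rule inj_onI, rule ext)
      fix g h j
      assume "g \<in> ternary_words n" "h \<in> ternary_words n"
        and "g(n := (- sum g {..<n}) mod 3) = h(n := (- sum h {..<n}) mod 3)"
      \<comment> \<open>At \<open>n\<close> itself both functions are \<open>undefined\<close>, so
        the update erases no information.\<close>
      then show "g j = h j"
        using ternary_words_undefined[of _ n n] by (metis fun_upd_other less_irrefl)
    qed
    show "(\<lambda>g. g(n := (- sum g {..<n}) mod 3)) ` ternary_words n = sum_zero_words (Suc n)"
    proof (intro subset_antisym subsetI)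
      fix x assume "x \<in> (\<lambda>g. g(n := (- sum g {..<n}) mod 3)) ` ternary_words n"
      then obtain g where g: "g \<in> ternary_words n" and x: "x = g(n := (- sum g {..<n}) mod 3)"
        by auto
      have "(- sum g {..<n}) mod 3 \<in> {0, 1, 2}" by auto
      then have "x \<in> ternary_words (Suc n)"
        unfolding x using g by (intro upd_in_ternary_words)
      moreover have "3 dvd sum x {..<Suc n}"
        unfolding x by (simp add: sum_upd_above dvd_eq_mod_eq_0 mod_simps)
      ultimately show "x \<in> sum_zero_words (Suc n)"
        by (simp add: sum_zero_words_def)
    next
      fix x assume x: "x \<in> sum_zero_words (Suc n)"
      then obtain g c where g: "g \<in> ternary_words n" and c: "c \<in> {0, 1, 2}" and xg: "x = g(n := c)"
        using ternary_words_Suc[of x n] by (auto simp: sum_zero_words_def)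
      have "3 dvd sum g {..<n} + c"
        using x by (simp add: sum_zero_words_def xg sum_upd_above)
      then have "c = (- sum g {..<n}) mod 3"
        using c by auto presburger+
      then show "x \<in> (\<lambda>g. g(n := (- sum g {..<n}) mod 3)) ` ternary_words n"
        using g xg by auto
    qed
  qed
  then show ?thesis
    using bij_betw_same_card card_ternary_words by metis
qed

lemma sum_zero_words_0: "sum_zero_words 0 = {\<lambda>_. undefined}"
  by (auto simp: sum_zero_words_def ternary_words_def)

lemma matching_words_0: "matching_words 0 = {}"
  by (auto simp: matching_words_def leads_def)

text \<open>Appending 0 keeps the leading position; appending a nonzero value moves it to
  \<open>n\<close>, and the prefix to be summed is then all of \<open>g\<close>.\<close>

lemma leads_Suc_upd:
  "(\<exists>i. leads (g(n := c)) (Suc n) i) \<longleftrightarrow>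
    (if c = 0 then \<exists>i. leads g n i else 3 dvd sum g {..<n})"
proof (cases "c = 0")
  case True
  have "leads (g(n := 0)) (Suc n) i \<longleftrightarrow> leads g n i" for i
    by (cases "i < n") (auto simp: leads_def sum_upd_above less_Suc_eq)
  then show ?thesis using True by simp
next
  case False
  have "leads (g(n := c)) (Suc n) i \<longleftrightarrow> i = n \<and> 3 dvd sum g {..<n}" for i
    using False by (auto simp: leads_def sum_upd_above less_Suc_eq)
  then show ?thesis using False by simp
qed

text \<open>Splitting by the value of the last coordinate gives three disjoint pieces, and thus a
  recursion for the cardinality.\<close>

lemma matching_words_Suc:
  "matching_words (Suc n) =
    (\<lambda>g. g(n := 0)) ` matching_words n \<union>
    ((\<lambda>g. g(n := 1)) ` sum_zero_words n \<union> (\<lambda>g. g(n := 2)) ` sum_zero_words n)"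
  (is "?L = ?R")
proof (intro subset_antisym subsetI)
  fix x assume "x \<in> ?L"
  then have x: "x \<in> ternary_words (Suc n)" and lead: "\<exists>i. leads x (Suc n) i"
    by (auto simp: matching_words_def)
  from x obtain g c where "g \<in> ternary_words n" "c \<in> {0, 1, 2}" "x = g(n := c)"
    unfolding ternary_words_Suc by blast
  with lead show "x \<in> ?R"
    unfolding matching_words_def sum_zero_words_def by (auto simp: leads_Suc_upd)
next
  fix x assume "x \<in> ?R"
  then show "x \<in> ?L"
    unfolding matching_words_def sum_zero_words_def
    by (auto simp: leads_Suc_upd upd_in_ternary_words)
qed

lemma card_image_upd:
  assumes "A \<subseteq> ternary_words n"
  shows "card ((\<lambda>g. g(n := c)) ` A) = card A"
proof (rule card_image, rule inj_onI, rule ext)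
  fix g h j
  assume "g \<in> A" "h \<in> A" "g(n := c) = h(n := c)"
  then show "g j = h j"
    using assms ternary_words_undefined[of _ n n] by (metis fun_upd_other less_irrefl subsetD)
qed

lemma card_matching_words_Suc_rec:
  "card (matching_words (Suc n)) = card (matching_words n) + 2 * card (sum_zero_words n)"
proof -
  have sub: "matching_words n \<subseteq> ternary_words n" "sum_zero_words n \<subseteq> ternary_words n"
    by (auto simp: matching_words_def sum_zero_words_def)
  then have fin: "finite (matching_words n)" "finite (sum_zero_words n)"
    using finite_ternary_words finite_subset by blast+
  have disj: "(\<lambda>g. g(n := a)) ` A \<inter> (\<lambda>g. g(n := b)) ` B = {}"
    if "a \<noteq> b" for a b :: int and A B
    using that by (auto simp: fun_eq_iff) metis
  show ?thesis
    unfolding matching_words_Suc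
    using fin by (simp add: card_Un_disjoint disj Int_Un_distrib card_image_upd sub)
qed

lemma card_matching_words_Suc: "card (matching_words (Suc n)) = 3 ^ n + 1"
proof (induction n)
  case 0
  \<comment> \<open>The empty word has sum zero, so both its nonzero extensions count:
    \<open>2 = 3 ^ 0 + 1\<close>. The surplus 1 over the independence bound arises here.\<close>
  then show ?case
    by (simp add: card_matching_words_Suc_rec matching_words_0 sum_zero_words_0)
next
  case (Suc n)
  then show ?case
    by (subst card_matching_words_Suc_rec) (simp add: card_sum_zero_words_Suc)
qed

section \<open>Adjacency within the large set\<close>

text \<open>If \<open>i < l\<close>, then \<open>x\<close> vanishes at \<open>l\<close> and
  \<open>y\<close> does not, so the words agree before \<open>l\<close>. There the sum of
  \<open>y\<close> is divisible by 3, while that of \<open>x\<close> is a multiple of 3 plus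
  \<open>x i\<close>, which is 1 or 2. With the roles exchanged, adjacent words share their leading
  position.\<close>

lemma leads_position_le:
  assumes x: "x \<in> ternary_words r" and y: "y \<in> ternary_words r"
    and i: "leads x r i" and l: "leads y r l" and xy: "differ_once x y"
  shows "l \<le> i"
proof (rule ccontr)
  assume "\<not> l \<le> i"
  then have il: "i < l" and lr: "l < r" using l by (auto simp: leads_def)
  then have "x l \<noteq> y l" using i l by (auto simp: leads_def)
  then have eq: "x j = y j" if "j \<noteq> l" for j
    using xy that unfolding differ_once_def by metis
  \<comment> \<open>The entries of \<open>x\<close> strictly between \<open>i\<close> and
    \<open>l\<close> are zero, so only those up to and including \<open>i\<close>
    contribute.\<close>
  have "{..<l} = {..<Suc i} \<union> {i<..<l}" using il by auto
  moreover have "sum x ({..<Suc i} \<union> {i<..<l}) = sum x {..<Suc i} + sum x {i<..<l}"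
    by (rule sum.union_disjoint) auto
  moreover have "sum x {i<..<l} = 0"
    using i lr by (intro sum.neutral) (auto simp: leads_def)
  ultimately have "sum x {..<l} = sum x {..<i} + x i"
    by simp
  moreover have "sum x {..<l} = sum y {..<l}"
    using eq by (intro sum.cong) auto
  ultimately have "3 dvd x i"
    using i l by (simp add: leads_def) (metis dvd_add_right_iff)
  moreover have "x i \<noteq> 0" "x i \<in> {0, 1, 2}"
    using i ternary_words_range[OF x] by (auto simp: leads_def)
  ultimately show False by auto
qed

text \<open>With a common leading position \<open>i\<close>, the differing coordinate is not after
  \<open>i\<close>, where both words vanish, nor before \<open>i\<close>, where one change would
  spoil divisibility of the prefix sum. At \<open>i\<close> the two values are 1 and 2 in some
  order, with sum 3.\<close>

lemma matching_neighbour_unique: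
  assumes x: "x \<in> ternary_words r" and i: "leads x r i"
    and y: "y \<in> matching_words r" and xy: "differ_once x y"
  shows "y = x(i := 3 - x i)"
proof -
  from y obtain l where y': "y \<in> ternary_words r" and l: "leads y r l"
    by (auto simp: matching_words_def)
  have "l = i"
    using leads_position_le[OF x y' i l xy] leads_position_le[OF y' x l i] xy
    by (simp add: differ_once_commute)
  note l = l[unfolded this]
  from xy obtain k where k: "x k \<noteq> y k" and eq: "\<And>j. j \<noteq> k \<Longrightarrow> x j = y j"
    by (auto simp: differ_once_def)
  have kr: "k < r"
    using k ternary_words_undefined[OF x] ternary_words_undefined[OF y'] by metis
  have "\<not> i < k"
    using k kr i l by (auto simp: leads_def)
  moreover have "\<not> k < i"
  proof
    assume "k < i"
    then have *: "sum z {..<i} = z k + sum z ({..<i} - {k})" for z :: "nat \<Rightarrow> int"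
      by (intro sum.remove) auto
    have "sum x ({..<i} - {k}) = sum y ({..<i} - {k})"
      using eq by (intro sum.cong) auto
    then have "sum x {..<i} - sum y {..<i} = x k - y k"
      using *[of x] *[of y] by simp
    then have "3 dvd x k - y k"
      using i l by (metis dvd_diff leads_def)
    then show False
      using k ternary_words_range[OF x kr] ternary_words_range[OF y' kr] by auto
  qed
  ultimately have "k = i" by simp
  moreover have "x i \<noteq> 0" "y i \<noteq> 0"
    using i l by (auto simp: leads_def)
  ultimately have "y i = 3 - x i"
    using k kr ternary_words_range[OF x kr] ternary_words_range[OF y' kr] by auto
  then show ?thesis
    using eq \<open>k = i\<close> by auto
qed

lemma max_degree_matching_words:
  "max_degree (induced_subgraph (hamming_graph (Suc n)) (matching_words (Suc n))) \<le> 1"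
proof -
  let ?K = "matching_words (Suc n)"
  have sub: "?K \<subseteq> ternary_words (Suc n)"
    by (auto simp: matching_words_def)
  then have fin: "finite ?K"
    using finite_ternary_words finite_subset by blast
  \<comment> \<open>\<open>Max\<close> over an empty set of degrees would be unspecified.\<close>
  have "?K \<noteq> {}"
    using card_matching_words_Suc[of n] by auto
  moreover have "degree (induced_subgraph (hamming_graph (Suc n)) ?K) x \<le> 1" if x: "x \<in> ?K" for x
  proof -
    obtain i where "x \<in> ternary_words (Suc n)" "leads x (Suc n) i"
      using x by (auto simp: matching_words_def)
    then have "{y \<in> ?K. differ_once x y} \<subseteq> {x(i := 3 - x i)}"
      using matching_neighbour_unique by auto
    from card_mono[OF _ this] have "card {y \<in> ?K. differ_once x y} \<le> 1"
      by simp
    then show ?thesis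
      by (simp add: degree_induced_hamming_graph[OF sub x])
  qed
  ultimately show ?thesis
    unfolding max_degree_def
    using fin by (subst Max_le_iff) (auto simp: verts_def induced_subgraph_def)
qed

theorem theorem8p1:
  fixes r :: nat
  assumes "0 < r"
  shows "sensitivity (cayley_graph (int_mod_power 3 r) {unit_vector r i | i. i < r}) = 1"
proof -
  obtain n where r: "r = Suc n"
    using assms gr0_implies_Suc by blast
  let ?G = "hamming_graph r"
  let ?D = "{max_degree (induced_subgraph ?G K) | K. K \<subseteq> verts ?G \<and> card K > independence_number ?G}"
  have K: "matching_words r \<subseteq> verts ?G"
    by (auto simp: matching_words_def verts_hamming_graph)
  have card: "independence_number ?G < card (matching_words r)"
    using independence_number_le[of n] by (simp add: r card_matching_words_Suc)
  \<comment> \<open>The lower bound holds for every set exceeding the independence number, the upper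
    bound for this particular one.\<close>
  have "max_degree (induced_subgraph ?G (matching_words r)) = 1"
    using max_degree_ge_1[of "matching_words r" r] max_degree_matching_words[of n] K card
    by (simp add: r verts_hamming_graph)
  then have "1 \<in> ?D"
    using K card by (intro CollectI exI[of _ "matching_words r"]) simp
  moreover have "finite ?D"
  proof -
    have "finite ((\<lambda>K. max_degree (induced_subgraph ?G K)) ` Pow (ternary_words r))"
      by (simp add: finite_ternary_words)
    then show ?thesis
      by (rule rev_finite_subset) (auto simp: verts_hamming_graph)
  qed
  moreover have "1 \<le> d" if "d \<in> ?D" for d
    using that max_degree_ge_1 by (auto simp: verts_hamming_graph)
  ultimately show ?thesis
    unfolding sensitivity_def by (intro Min_eqI)
qed

end
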